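(* Let $A, B, X$ be $n\times n$ complex matrices such that $A$ and $B$ are positive semidefinite. If $\phi:[0,\infty)\to\mathbb{R}$ is a strictly increasing convex function and $0<\nu\leq\frac12$, then $$\phi\left(r^{2}\|AX+XB\|_2^2\right)-\phi\left(4\left(r^{2}\|A^{\frac12}XB^{\frac12}\|_2^2+r_0\|A^{\frac34}XB^{\frac14}\|_2^2\right)-r_0\|A^{\frac12}XB^{\frac12}+AX\|_2^2\right)$$ $$\leq\phi\left(\|(1-\nu)AX+\nu XB\|_2^2\right)-\phi\left(\|A^{1-\nu}XB^{\nu}\|_2^2\right)$$ $$\leq\phi\left(R^{2}\|AX+XB\|_2^2\right)-\phi\left(4\left(R^{2}\|A^{\frac12}XB^{\frac12}\|_2^2+\|A^{\frac14}XB^{\frac34}\|_2^2\right)-r_0\|A^{\frac12}XB^{\frac12}+XB\|_2^2\right),$$ where $r=\min\{\nu,1-\nu\}$, $R=\max\{\nu,1-\nu\}$ and $r_0=\min\{2r,1-2r\}$.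
   Context: $\|\cdot\|_2$ is the Hilbert-Schmidt norm: $\|T\|_2=\left(\sum_{i,j=1}^n|t_{ij}|^2\right)^{1/2}$ for $T=[t_{ij}]$. Real powers of positive semidefinite matrices are defined by the spectral functional calculus.
   Formalization: The printed upper bound fails for n=1, A=B=X=1; a factor r_0 is inserted before ‖A^{1/4}XB^{3/4}‖². As φ is defined only on [0,∞), each inequality is asserted only when the argument of its subtracted outer φ-term is nonnegative. *)

theory Defs
  imports "HOL-Analysis.Analysis"
begin

definition adjoint_mat :: "complex^'n^'m \<Rightarrow> complex^'m^'n" where
  "adjoint_mat A = (\<chi> i j. cnj (A $ j $ i))"

definition unitary_mat :: "complex^'n^'n \<Rightarrow> bool" where
  "unitary_mat U \<longleftrightarrow> adjoint_mat U ** U = mat 1 \<and> U ** adjoint_mat U = mat 1"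

text \<open>The quadratic form of a Hermitian matrix is real-valued, so taking its real part
  loses nothing.\<close>

definition pos_semidef :: "complex^'n^'n \<Rightarrow> bool" where
  "pos_semidef A \<longleftrightarrow> adjoint_mat A = A \<and>
     (\<forall>x. 0 \<le> Re (\<Sum>i\<in>UNIV. cnj (x $ i) * (A *v x) $ i))"

definition real_diag :: "('n \<Rightarrow> real) \<Rightarrow> complex^'n^'n" where
  "real_diag d = (\<chi> i j. if i = j then complex_of_real (d i) else 0)"

text \<open>If \<open>A = U diag(d) U*\<close> with \<open>U\<close> unitary and \<open>d\<close> real, then \<open>f(A) = U diag(f \<circ> d) U*\<close>.
  Every Hermitian \<open>A\<close> has such a diagonalization, and \<open>f(A)\<close> does not depend on its choice.
  For non-Hermitian \<open>A\<close> the value is unspecified.\<close>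

definition spectral_calculus :: "(real \<Rightarrow> real) \<Rightarrow> complex^'n^'n \<Rightarrow> complex^'n^'n" where
  "spectral_calculus f A = (THE M. \<exists>U d. unitary_mat U \<and>
     A = U ** real_diag d ** adjoint_mat U \<and>
     M = U ** real_diag (f \<circ> d) ** adjoint_mat U)"

text \<open>Intended for positive semidefinite \<open>A\<close> and \<open>p > 0\<close>; on the eigenvalue \<open>0\<close> we have
  \<open>0 powr p = 0\<close>.\<close>

definition mat_powr :: "complex^'n^'n \<Rightarrow> real \<Rightarrow> complex^'n^'n" where
  "mat_powr A p = spectral_calculus (\<lambda>t. t powr p) A"

definition hs_norm :: "complex^'n^'m \<Rightarrow> real" where
  "hs_norm T = sqrt (\<Sum>i\<in>UNIV. \<Sum>j\<in>UNIV. (cmod (T $ i $ j))\<^sup>2)"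

end

theory Submission
  imports Defs
begin

text \<open>
  Diagonalize \<open>A = U diag(d) U*\<close> and \<open>B = V diag(e) V*\<close>, and put \<open>Y = U* X V\<close>. In these bases
  every matrix in the statement becomes an entrywise multiple of \<open>Y\<close>: its entry \<open>(i, j)\<close> is
  \<open>c (d i) (e j) Y(i, j)\<close> for a scalar function \<open>c\<close> of two nonnegative numbers. The
  Hilbert-Schmidt norm is unitarily invariant, so each squared norm is the sum of
  \<open>(c (d i) (e j))\<^sup>2\<close> with the nonnegative weights \<open>|Y(i, j)|\<^sup>2\<close>, and linear inequalities between
  squared norms follow from the same inequalities between the scalars \<open>(c a b)\<^sup>2\<close>.

  Since \<open>r = \<nu>\<close> and \<open>R = 1 - \<nu>\<close>, and the quarter powers complete a square, the scalar
  versions of \<open>lo\<close> and \<open>up\<close> are \<open>4 \<nu>\<^sup>2 a b - r0 (a - sqrt (a b))\<^sup>2\<close> and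
  \<open>4 (1 - \<nu>)\<^sup>2 a b - r0 (b - sqrt (a b))\<^sup>2\<close>. For \<open>\<phi>\<close> the identity, the lower bound then reduces to
  the refined Young inequality of Kittaneh and Manasrah with weight \<open>2 \<nu>\<close> for the numbers \<open>a\<^sup>2\<close>
  and \<open>a b\<close> (\<open>lower_scalar_comparison\<close>), and the upper bound to Young's inequality outside the
  unit interval (\<open>upper_scalar_comparison\<close>).

  The passage to an increasing convex \<open>\<phi>\<close> is \<open>convex_increasing_increment_mono\<close>: an interval
  that is at least as long and has the larger right end point has the larger increment of \<open>\<phi>\<close>.
  The left end points come in either order: \<open>lo\<close> can exceed the squared norm of
  \<open>A^(1-\<nu>) X B^\<nu>\<close>, for instance when \<open>\<nu>\<close> is slightly below \<open>1/2\<close>, \<open>X\<close> and \<open>A\<close> are the identity and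
  \<open>B\<close> is a large multiple of it.

  The spectral theorem is obtained from maxima of the Rayleigh quotient
  (\<open>self_adjoint_has_eigenvector\<close>, \<open>hermitian_diagonalization\<close>).
\<close>

section \<open>Scalar inequalities\<close>

lemma Young_powr:
  fixes p q \<mu> :: real
  assumes "0 \<le> \<mu>" "\<mu> \<le> 1" "0 \<le> p" "0 \<le> q"
  shows "p powr (1 - \<mu>) * q powr \<mu> \<le> (1 - \<mu>) * p + \<mu> * q"
proof (cases "p = 0 \<or> q = 0")
  case True
  then show ?thesis using assms by auto
next
  case False
  then show ?thesis using Youngs_inequality_0 [of "1 - \<mu>" \<mu> p q] assms by auto
qed

text \<open>For \<open>\<mu> \<le> 1/2\<close>, moving the square to the right leaves \<open>(1 - 2 \<mu>) p + 2 \<mu> sqrt (p q)\<close>, so this is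
  the plain Young inequality for \<open>p\<close> and \<open>sqrt (p q)\<close> with weight \<open>2 \<mu>\<close>.\<close>

lemma Young_refined_half:
  fixes p q \<mu> :: real
  assumes "0 \<le> \<mu>" "\<mu> \<le> 1 / 2" "0 \<le> p" "0 \<le> q"
  shows "p powr (1 - \<mu>) * q powr \<mu> + \<mu> * (sqrt p - sqrt q)\<^sup>2 \<le> (1 - \<mu>) * p + \<mu> * q"
proof -
  have eq: "p powr (1 - 2 * \<mu>) * (sqrt p * sqrt q) powr (2 * \<mu>) = p powr (1 - \<mu>) * q powr \<mu>"
  proof (cases "p = 0")
    case True
    then show ?thesis by simp
  next
    case False
    have "(sqrt p * sqrt q) powr (2 * \<mu>) = p powr \<mu> * q powr \<mu>"
      using assms by (simp add: powr_mult powr_half_sqrt [symmetric] powr_powr)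
    moreover have "p powr (1 - 2 * \<mu>) * p powr \<mu> = p powr (1 - \<mu>)"
      using False by (simp add: powr_add [symmetric])
    ultimately show ?thesis by (simp add: mult.assoc [symmetric])
  qed
  have "p powr (1 - 2 * \<mu>) * (sqrt p * sqrt q) powr (2 * \<mu>)
          \<le> (1 - 2 * \<mu>) * p + 2 * \<mu> * (sqrt p * sqrt q)"
    using Young_powr [of "2 * \<mu>" p "sqrt p * sqrt q"] assms by simp
  moreover have sq: "(sqrt p - sqrt q)\<^sup>2 = p + q - 2 * (sqrt p * sqrt q)"
    using assms by (simp add: power2_diff)
  ultimately show ?thesis unfolding eq sq by (simp add: algebra_simps)
qed

text \<open>The inequality of Kittaneh and Manasrah; exchanging \<open>p\<close> and \<open>q\<close> reduces it to weights at most
  one half.\<close>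

lemma Young_refined:
  fixes p q \<mu> :: real
  assumes "0 \<le> \<mu>" "\<mu> \<le> 1" "0 \<le> p" "0 \<le> q"
  shows "p powr (1 - \<mu>) * q powr \<mu> + min \<mu> (1 - \<mu>) * (sqrt p - sqrt q)\<^sup>2
          \<le> (1 - \<mu>) * p + \<mu> * q"
proof (cases "\<mu> \<le> 1 / 2")
  case True
  then show ?thesis using Young_refined_half [of \<mu> p q] assms by (simp add: min_def)
next
  case False
  then show ?thesis using Young_refined_half [of "1 - \<mu>" q p] assms
    by (simp add: min_def mult.commute power2_commute [of "sqrt q"] add.commute)
qed

text \<open>For \<open>b > 0\<close> and \<open>t = a / b\<close> this is Bernoulli's inequality \<open>t powr \<mu> \<ge> 1 + \<mu> (t - 1)\<close>. It is
  Young's inequality with weight \<open>1 / \<mu>\<close>, which expresses \<open>a b\<close> as a geometric mean of \<open>b\<^sup>2\<close> and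
  \<open>a powr \<mu> * b powr (2 - \<mu>)\<close>.\<close>

lemma Young_reversed:
  fixes a b \<mu> :: real
  assumes "1 \<le> \<mu>" "0 \<le> a" "0 \<le> b"
  shows "\<mu> * (a * b) \<le> (\<mu> - 1) * b\<^sup>2 + a powr \<mu> * b powr (2 - \<mu>)"
proof (cases "a = 0 \<or> b = 0")
  case True
  then show ?thesis using assms by auto
next
  case False
  then have pos: "0 < a" "0 < b" using assms by auto
  have "(b\<^sup>2) powr (1 - 1 / \<mu>) * (a powr \<mu> * b powr (2 - \<mu>)) powr (1 / \<mu>)
      \<le> (1 - 1 / \<mu>) * b\<^sup>2 + 1 / \<mu> * (a powr \<mu> * b powr (2 - \<mu>))"
    by (rule Young_powr) (use assms in auto)
  moreover have "(b\<^sup>2) powr (1 - 1 / \<mu>) * (a powr \<mu> * b powr (2 - \<mu>)) powr (1 / \<mu>) = a * b"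
  proof -
    have "(b\<^sup>2) powr (1 - 1 / \<mu>) = b powr (2 - 2 / \<mu>)"
      using pos by (simp add: powr_powr powr_numeral [symmetric] algebra_simps
          del: powr_numeral)
    moreover have "(a powr \<mu> * b powr (2 - \<mu>)) powr (1 / \<mu>) = a * b powr (2 / \<mu> - 1)"
      using pos assms by (simp add: powr_mult powr_powr diff_divide_distrib)
    moreover have "b powr (2 - 2 / \<mu>) * b powr (2 / \<mu> - 1) = b"
      using pos by (simp add: powr_add [symmetric])
    ultimately show ?thesis by (simp add: mult.left_commute)
  qed
  ultimately have "\<mu> * (a * b) \<le> \<mu> * ((1 - 1 / \<mu>) * b\<^sup>2 + 1 / \<mu> * (a powr \<mu> * b powr (2 - \<mu>)))"
    using assms by (intro mult_left_mono) auto
  also have "\<dots> = (\<mu> - 1) * b\<^sup>2 + a powr \<mu> * b powr (2 - \<mu>)"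
    using assms by (simp add: field_simps)
  finally show ?thesis .
qed

lemma square_of_powr_product:
  fixes a b s t :: real
  shows "(a powr s * b powr t)\<^sup>2 = a powr (2 * s) * b powr (2 * t)"
proof -
  have "(x powr u)\<^sup>2 = x powr (2 * u)" for x u :: real
    by (simp only: power2_eq_square powr_add [symmetric] mult_2)
  then show ?thesis by (simp only: power_mult_distrib)
qed

text \<open>With \<open>g = sqrt (a b)\<close> one has \<open>(a powr (3/4) * b powr (1/4))\<^sup>2 = a g\<close>, and
  \<open>4 a g - (g + a)\<^sup>2 = - (a - g)\<^sup>2\<close>.\<close>

lemma lower_terms_defect:
  fixes a b r r0 :: real
  assumes "0 \<le> a" "0 \<le> b"
  shows "4 * (r\<^sup>2 * (a powr (1/2) * b powr (1/2))\<^sup>2 + r0 * (a powr (3/4) * b powr (1/4))\<^sup>2)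
           - r0 * (a powr (1/2) * b powr (1/2) + a)\<^sup>2
         = 4 * r\<^sup>2 * (a * b) - r0 * (a - sqrt a * sqrt b)\<^sup>2"
proof -
  have s: "a powr (1/2) = sqrt a" "b powr (1/2) = sqrt b"
    using assms by (simp_all add: powr_half_sqrt)
  have "a powr (3/2) = a * sqrt a"
  proof -
    have "a powr (3/2) = a powr (1 + 1/2)" by simp
    also have "\<dots> = a * sqrt a"
      using assms unfolding powr_add by (simp add: powr_half_sqrt)
    finally show ?thesis .
  qed
  then have q: "(a powr (3/4) * b powr (1/4))\<^sup>2 = a * (sqrt a * sqrt b)"
    by (simp add: square_of_powr_product s)
  have h: "(sqrt a * sqrt b)\<^sup>2 = a * b" using assms by (simp add: power_mult_distrib)
  show ?thesis unfolding q s power2_sum power2_diff h by (simp add: algebra_simps)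
qed

text \<open>The difference \<open>((1 - \<nu>) a + \<nu> b)\<^sup>2 - (\<nu> (a + b))\<^sup>2 + 4 \<nu>\<^sup>2 a b\<close> equals
  \<open>(1 - 2 \<nu>) a\<^sup>2 + 2 \<nu> a b\<close>, an arithmetic mean of \<open>a\<^sup>2\<close> and \<open>a b\<close> whose geometric counterpart is
  \<open>(a powr (1 - \<nu>) * b powr \<nu>)\<^sup>2\<close>.\<close>

lemma lower_scalar_comparison:
  fixes a b \<nu> :: real
  assumes "0 \<le> a" "0 \<le> b" "0 < \<nu>" "\<nu> \<le> 1 / 2"
  shows "(\<nu> * (a + b))\<^sup>2 + (a powr (1 - \<nu>) * b powr \<nu>)\<^sup>2
       \<le> ((1 - \<nu>) * a + \<nu> * b)\<^sup>2
         + (4 * \<nu>\<^sup>2 * (a * b) - min (2 * \<nu>) (1 - 2 * \<nu>) * (a - sqrt a * sqrt b)\<^sup>2)"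
proof -
  have eq: "(a\<^sup>2) powr (1 - 2 * \<nu>) * (a * b) powr (2 * \<nu>) = (a powr (1 - \<nu>) * b powr \<nu>)\<^sup>2"
  proof (cases "a = 0")
    case True
    then show ?thesis by simp
  next
    case False
    then have "(a\<^sup>2) powr (1 - 2 * \<nu>) = a powr (2 * (1 - 2 * \<nu>))"
      using assms by (simp add: powr_powr powr_numeral [symmetric] del: powr_numeral)
    moreover have "a powr (2 * (1 - 2 * \<nu>)) * a powr (2 * \<nu>) = a powr (2 * (1 - \<nu>))"
      by (simp add: powr_add [symmetric] algebra_simps)
    ultimately show ?thesis
      using assms by (simp add: square_of_powr_product powr_mult mult.assoc [symmetric])
  qed
  have "(a powr (1 - \<nu>) * b powr \<nu>)\<^sup>2
          + min (2 * \<nu>) (1 - 2 * \<nu>) * (a - sqrt a * sqrt b)\<^sup>2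
        \<le> (1 - 2 * \<nu>) * a\<^sup>2 + 2 * \<nu> * (a * b)"
    using Young_refined [of "2 * \<nu>" "a\<^sup>2" "a * b"] assms
    unfolding eq by (simp add: real_sqrt_mult)
  then show ?thesis by (simp add: power2_eq_square algebra_simps)
qed

text \<open>Here \<open>((1 - \<nu>) (a + b))\<^sup>2 - ((1 - \<nu>) a + \<nu> b)\<^sup>2 - 4 (1 - \<nu>)\<^sup>2 a b\<close> equals
  \<open>(1 - 2 \<nu>) b\<^sup>2 - 2 (1 - \<nu>) a b\<close>. The reversed inequality with exponent \<open>2 (1 - \<nu>) \<ge> 1\<close> bounds
  it below by \<open>- (a powr (1 - \<nu>) * b powr \<nu>)\<^sup>2\<close>, and the term with
  \<open>min (2 \<nu>) (1 - 2 \<nu>)\<close> lowers the left-hand side further.\<close>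

lemma upper_scalar_comparison:
  fixes a b \<nu> :: real
  assumes "0 \<le> a" "0 \<le> b" "0 < \<nu>" "\<nu> \<le> 1 / 2"
  shows "((1 - \<nu>) * a + \<nu> * b)\<^sup>2
           + (4 * (1 - \<nu>)\<^sup>2 * (a * b) - min (2 * \<nu>) (1 - 2 * \<nu>) * (b - sqrt b * sqrt a)\<^sup>2)
       \<le> ((1 - \<nu>) * (a + b))\<^sup>2 + (a powr (1 - \<nu>) * b powr \<nu>)\<^sup>2"
proof -
  have exps: "2 * (1 - \<nu>) - 1 = 1 - 2 * \<nu>" "2 - 2 * (1 - \<nu>) = 2 * \<nu>" by simp_all
  have "2 * (1 - \<nu>) * (a * b) \<le> (1 - 2 * \<nu>) * b\<^sup>2 + (a powr (1 - \<nu>) * b powr \<nu>)\<^sup>2"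
    using Young_reversed [of "2 * (1 - \<nu>)" a b] assms
    unfolding square_of_powr_product exps by simp
  moreover have "0 \<le> min (2 * \<nu>) (1 - 2 * \<nu>) * (b - sqrt b * sqrt a)\<^sup>2"
    using assms by simp
  ultimately show ?thesis by (simp add: power2_eq_square algebra_simps)
qed

section \<open>Increments of an increasing convex function\<close>

text \<open>If \<open>x' \<le> x\<close>, monotonicity compares the two end points separately. Otherwise translate
  \<open>[x, y]\<close> to the right until it starts at \<open>x'\<close>: convexity makes the increment grow, and the
  translated interval still ends before \<open>y'\<close>.\<close>

lemma convex_increasing_increment_mono:
  fixes \<phi> :: "real \<Rightarrow> real" and x y x' y' :: real
  assumes \<phi>: "mono_on {0..} \<phi>" "convex_on {0..} \<phi>"
    and "0 \<le> x" "x \<le> y" "0 \<le> x'" "y \<le> y'" "y - x \<le> y' - x'"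
  shows "\<phi> y - \<phi> x \<le> \<phi> y' - \<phi> x'"
proof (cases "x' \<le> x")
  case True
  then have "\<phi> x' \<le> \<phi> x" "\<phi> y \<le> \<phi> y'"
    using assms by (auto intro: mono_onD)
  then show ?thesis by simp
next
  case False
  define z t where "z = x' + (y - x)" and "t = (y - x) / (z - x)"
  have z: "x < z" using False assms by (simp add: z_def)
  have t: "0 \<le> t" "t \<le> 1" using z False assms by (auto simp: t_def z_def)
  have tz: "t * (z - x) = y - x" using z by (simp add: t_def)
  \<comment> \<open>Both \<open>y\<close> and \<open>x'\<close> lie between \<open>x\<close> and \<open>z\<close>, with exchanged weights because \<open>y + x' = x + z\<close>.\<close>
  have "\<phi> ((1 - t) * x + t * z) \<le> (1 - t) * \<phi> x + t * \<phi> z"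
    using convex_onD [OF \<phi>(2) t, of x z] z assms by simp
  moreover have "\<phi> ((1 - t) * z + t * x) \<le> (1 - t) * \<phi> z + t * \<phi> x"
    using convex_onD [OF \<phi>(2) t, of z x] z assms by simp
  moreover have "(1 - t) * x + t * z = y" "(1 - t) * z + t * x = x'"
    using tz by (simp_all add: algebra_simps z_def)
  ultimately have "\<phi> y + \<phi> x' \<le> \<phi> x + \<phi> z" by (simp add: algebra_simps)
  moreover have "\<phi> z \<le> \<phi> y'"
    using assms z by (auto intro!: mono_onD [OF \<phi>(1)] simp: z_def)
  ultimately show ?thesis by simp
qed

section \<open>The spectral theorem for Hermitian matrices\<close>

text \<open>A maximizer \<open>v\<close> of the Rayleigh quotient on the unit sphere of \<open>W\<close> is an eigenvector: with
  \<open>u = f v - l v\<close>, moving from \<open>v\<close> to \<open>v + t u\<close> would increase the quotient at first order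
  in \<open>t\<close> unless \<open>u = 0\<close>. A real inner product space is the right setting even for Hermitian matrices, because their
  eigenvalues are real and the real part of the complex inner product is symmetric.\<close>

lemma self_adjoint_has_eigenvector:
  fixes f :: "'a::euclidean_space \<Rightarrow> 'a"
  assumes "linear f" and W: "subspace W" "w \<in> W" "w \<noteq> 0"
    and inv: "\<And>x. x \<in> W \<Longrightarrow> f x \<in> W"
    and adj: "\<And>x y. f x \<bullet> y = x \<bullet> f y"
  shows "\<exists>v\<in>W. norm v = 1 \<and> (\<exists>l. f v = l *\<^sub>R v)"
proof -
  have cont: "continuous_on S f" for S
    using \<open>linear f\<close> by (rule linear_continuous_on_compose [OF continuous_on_id])
  have "compact (W \<inter> sphere 0 1)"
    using closed_subspace [OF W(1)] by (simp add: closed_Int_compact)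
  moreover have "(1 / norm w) *\<^sub>R w \<in> W \<inter> sphere 0 1"
    using W by (simp add: subspace_scale)
  ultimately obtain v where v: "v \<in> W" "norm v = 1"
    and max: "\<And>z. z \<in> W \<Longrightarrow> norm z = 1 \<Longrightarrow> z \<bullet> f z \<le> v \<bullet> f v"
    using continuous_attains_sup [of "W \<inter> sphere 0 1" "\<lambda>x. x \<bullet> f x"]
    by (force intro: continuous_intros cont)
  define l u where "l = v \<bullet> f v" and "u = f v - l *\<^sub>R v"
  have le: "z \<bullet> f z \<le> l * (z \<bullet> z)" if "z \<in> W" for z
  proof (cases "z = 0")
    case True
    then show ?thesis by simp
  next
    case False
    have "(1 / norm z) *\<^sub>R z \<bullet> f ((1 / norm z) *\<^sub>R z) \<le> l"
      unfolding l_def using False that W by (intro max) (auto simp: subspace_scale)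
    then have "(z \<bullet> f z) / (norm z)\<^sup>2 \<le> l"
      by (simp add: linear_cmul [OF \<open>linear f\<close>] power2_eq_square field_simps)
    then show ?thesis
      using False by (simp add: power2_norm_eq_inner [symmetric] field_simps)
  qed
  have u: "u \<in> W"
    using v inv W by (simp add: u_def subspace_diff subspace_scale)
  define c where "c = l * (u \<bullet> u) - u \<bullet> f u"
  have "0 \<le> c" using le [OF u] by (simp add: c_def)
  have vv: "v \<bullet> v = 1" using v by (simp add: dot_square_norm)
  have quad: "2 * t * (u \<bullet> u) \<le> t\<^sup>2 * c" for t
  proof -
    have "v + t *\<^sub>R u \<in> W" using v u W by (simp add: subspace_add subspace_scale)
    from le [OF this] have
      "v \<bullet> f v + t * (v \<bullet> f u) + t * (u \<bullet> f v) + t\<^sup>2 * (u \<bullet> f u)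
        \<le> l * (1 + 2 * t * (u \<bullet> v) + t\<^sup>2 * (u \<bullet> u))"
      using vv by (simp add: linear_add [OF \<open>linear f\<close>] linear_cmul [OF \<open>linear f\<close>]
          inner_add_left inner_add_right power2_eq_square inner_commute [of v u] algebra_simps)
    moreover have "u \<bullet> u = u \<bullet> f v - l * (u \<bullet> v)"
      by (subst (2) u_def) (simp add: inner_diff_right)
    then have "u \<bullet> f v = u \<bullet> u + l * (u \<bullet> v)" by simp
    moreover from this have "v \<bullet> f u = u \<bullet> u + l * (u \<bullet> v)" by (metis adj inner_commute)
    ultimately show ?thesis by (simp add: c_def l_def [symmetric] algebra_simps)
  qed
  have "u = 0"
  proof (rule ccontr)
    assume "u \<noteq> 0"
    then have n: "0 < u \<bullet> u" by simp
    \<comment> \<open>Small enough for the linear term of \<open>quad\<close> to beat the quadratic one; the \<open>1\<close> covers \<open>c = 0\<close>.\<close>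
    define t where "t = (u \<bullet> u) / (c + 1)"
    have t: "0 < t" using n \<open>0 \<le> c\<close> by (simp add: t_def)
    have "t * (2 * (u \<bullet> u)) \<le> t * (t * c)"
      using quad [of t] by (simp add: power2_eq_square algebra_simps)
    then have "2 * (u \<bullet> u) \<le> t * c" using t by simp
    also have "\<dots> \<le> t * (c + 1)" using t by simp
    also have "\<dots> = u \<bullet> u" using \<open>0 \<le> c\<close> by (simp add: t_def)
    finally show False using n by simp
  qed
  then have "f v = l *\<^sub>R v" by (simp add: u_def)
  with v show ?thesis by blast
qed

definition cdot :: "complex^'n \<Rightarrow> complex^'n \<Rightarrow> complex" where
  "cdot x y = (\<Sum>i\<in>UNIV. cnj (x $ i) * y $ i)"

lemma inner_eq_Re_cdot: "x \<bullet> y = Re (cdot x y)"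
  by (simp add: cdot_def inner_vec_def inner_complex_def)

lemma cdot_same: "cdot x x = of_real ((norm x)\<^sup>2)"
proof -
  have "cdot x x = of_real (\<Sum>i\<in>UNIV. (cmod (x $ i))\<^sup>2)"
    unfolding cdot_def of_real_sum
    by (intro sum.cong refl) (metis complex_norm_square mult.commute)
  then show ?thesis by (simp add: norm_vec_def L2_set_def sum_nonneg)
qed

lemma cdot_commute: "cdot y x = cnj (cdot x y)"
  by (simp add: cdot_def mult.commute)

lemma cdot_add_right: "cdot x (y + z) = cdot x y + cdot x z"
  by (simp add: cdot_def sum.distrib algebra_simps)

lemma cdot_scaleR_right: "cdot x (c *\<^sub>R y) = of_real c * cdot x y"
  by (simp add: cdot_def sum_distrib_left scaleR_conv_of_real [where 'a = complex] algebra_simps)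

lemma cdot_scaleR_left: "cdot (c *\<^sub>R x) y = of_real c * cdot x y"
  by (simp add: cdot_def sum_distrib_left scaleR_conv_of_real [where 'a = complex] algebra_simps)

lemma cdot_matrix_adjoint: "cdot x (A *v y) = cdot (adjoint_mat A *v x) y"
proof -
  have "cdot x (A *v y) = (\<Sum>i\<in>UNIV. \<Sum>j\<in>UNIV. cnj (x $ i) * (A $ i $ j * y $ j))"
    by (simp add: cdot_def matrix_vector_mult_def sum_distrib_left)
  also have "\<dots> = (\<Sum>j\<in>UNIV. \<Sum>i\<in>UNIV. cnj (x $ i) * (A $ i $ j * y $ j))"
    by (rule sum.swap)
  also have "\<dots> = cdot (adjoint_mat A *v x) y"
    by (simp add: cdot_def matrix_vector_mult_def adjoint_mat_def sum_distrib_left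
        sum_distrib_right mult_ac)
  finally show ?thesis .
qed

text \<open>Fewer vectors than the dimension leave room for an orthogonal one: the square matrix with rows
  \<open>(v j)*\<close> for \<open>j \<in> J\<close> and zero rows elsewhere has the zero row \<open>k\<close>, hence a nontrivial kernel.\<close>

lemma exists_cdot_orthogonal:
  fixes v :: "'n::finite \<Rightarrow> complex^'n"
  assumes "k \<notin> J"
  shows "\<exists>w. w \<noteq> 0 \<and> (\<forall>j\<in>J. cdot (v j) w = 0)"
proof -
  define M :: "complex^'n^'n" where "M = (\<chi> i j. if i \<in> J then cnj (v i $ j) else 0)"
  have M: "(M *v x) $ i = (if i \<in> J then cdot (v i) x else 0)" for x i
    by (simp add: M_def matrix_vector_mult_def cdot_def)
  have "\<nexists>B. M ** B = mat 1"
  proof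
    assume "\<exists>B. M ** B = mat 1"
    then obtain B where "M ** B = mat 1" by blast
    moreover have "(M ** B) $ k $ k = 0"
      using assms by (simp add: M_def matrix_matrix_mult_def)
    ultimately show False by (simp add: mat_def)
  qed
  then obtain w where "w \<noteq> 0" "M *v w = 0"
    by (metis matrix_left_invertible_ker matrix_left_right_inverse)
  moreover have "cdot (v j) w = 0" if "j \<in> J" for j
    using M [of w j] \<open>M *v w = 0\<close> that by simp
  ultimately show ?thesis by blast
qed

text \<open>Indexing the eigenvectors by subsets \<open>J\<close> of the coordinate type makes \<open>J = UNIV\<close> a unitary
  matrix at once. To enlarge \<open>J\<close>, note that the orthogonal complement of the
  eigenvectors found so far is nonzero and invariant under \<open>A\<close>.\<close>

lemma hermitian_orthonormal_eigenvectors: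
  fixes A :: "complex^'n^'n" and J :: "'n set"
  assumes herm: "adjoint_mat A = A"
  shows "\<exists>v d. (\<forall>j\<in>J. \<forall>k\<in>J. cdot (v j) (v k) = (if j = k then 1 else 0)) \<and>
               (\<forall>j\<in>J. A *v v j = d j *\<^sub>R v j)"
proof (rule finite_induct [OF finite [of J]], goal_cases)
  case 1
  show ?case by simp
next
  case (2 k J)
  from 2(3) obtain v :: "'n \<Rightarrow> complex^'n" and d :: "'n \<Rightarrow> real"
    where orth: "\<forall>i\<in>J. \<forall>j\<in>J. cdot (v i) (v j) = (if i = j then 1 else 0)"
      and eig: "\<forall>j\<in>J. A *v v j = d j *\<^sub>R v j" by blast
  define W where "W = {x. \<forall>j\<in>J. cdot (v j) x = 0}"
  obtain w where "w \<noteq> 0" "w \<in> W"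
    using exists_cdot_orthogonal [OF 2(2), of v] by (auto simp: W_def)
  moreover have "subspace W"
    unfolding W_def subspace_def
    by (auto simp: cdot_add_right cdot_scaleR_right) (simp add: cdot_def)
  moreover have "A *v x \<in> W" if "x \<in> W" for x
    using that eig by (simp add: W_def cdot_matrix_adjoint herm cdot_scaleR_left)
  moreover have "(A *v x) \<bullet> y = x \<bullet> (A *v y)" for x y
    by (simp add: inner_eq_Re_cdot cdot_matrix_adjoint herm)
  ultimately obtain u l where u: "u \<in> W" "norm u = 1" "A *v u = l *\<^sub>R u"
    using self_adjoint_has_eigenvector [of "\<lambda>x. A *v x" W w] by auto
  have ou: "cdot (v j) u = 0" "cdot u (v j) = 0" if "j \<in> J" for j
    using u(1) that by (auto simp: W_def cdot_commute [of u])
  have uu: "cdot u u = 1" using u(2) by (simp add: cdot_same)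
  show ?case
  proof (intro exI conjI)
    show "\<forall>i\<in>insert k J. \<forall>j\<in>insert k J.
        cdot ((v(k := u)) i) ((v(k := u)) j) = (if i = j then 1 else 0)"
      using orth ou uu 2(2) by auto
    show "\<forall>j\<in>insert k J. A *v (v(k := u)) j = (d(k := l)) j *\<^sub>R (v(k := u)) j"
      using eig u(3) 2(2) by auto
  qed
qed

lemma matrix_mult_real_diag_right:
  "(M ** real_diag d) $ i $ j = M $ i $ j * of_real (d j)"
  by (simp add: matrix_matrix_mult_def real_diag_def if_distrib [of "\<lambda>z. _ * z"] cong: if_cong)

lemma matrix_mult_real_diag_left:
  "(real_diag d ** M) $ i $ j = of_real (d i) * M $ i $ j"
  by (simp add: matrix_matrix_mult_def real_diag_def if_distrib [of "\<lambda>z. z * _"] cong: if_cong)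

theorem hermitian_diagonalization:
  fixes A :: "complex^'n^'n"
  assumes "adjoint_mat A = A"
  obtains U d where "unitary_mat U" "A = U ** real_diag d ** adjoint_mat U"
    "\<And>j. A *v column j U = d j *\<^sub>R column j U"
proof -
  obtain v :: "'n \<Rightarrow> complex^'n" and d where
    orth: "\<And>j k. cdot (v j) (v k) = (if j = k then 1 else 0)" and
    eig: "\<And>j. A *v v j = d j *\<^sub>R v j"
    using hermitian_orthonormal_eigenvectors [OF assms, of UNIV] by auto
  define U :: "complex^'n^'n" where "U = (\<chi> i j. v j $ i)"
  have col: "column j U = v j" for j by (simp add: U_def column_def vec_eq_iff)
  have "adjoint_mat U ** U = mat 1"
    using orth by (simp add: vec_eq_iff matrix_matrix_mult_def adjoint_mat_def U_def mat_def cdot_def)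
  then have unit: "adjoint_mat U ** U = mat 1" "U ** adjoint_mat U = mat 1"
    using matrix_left_right_inverse by blast+
  have "(A ** U) $ i $ j = (U ** real_diag d) $ i $ j" for i j
  proof -
    have "(A ** U) $ i $ j = (A *v v j) $ i"
      by (simp add: matrix_matrix_mult_def matrix_vector_mult_def U_def)
    then show ?thesis
      unfolding matrix_mult_real_diag_right by (simp add: eig U_def scaleR_conv_of_real [where 'a = complex])
  qed
  then have "A ** U = U ** real_diag d" by (simp add: vec_eq_iff)
  then have "A = U ** real_diag d ** adjoint_mat U"
    by (metis matrix_mul_assoc matrix_mul_rid unit(2))
  then show thesis using that [of U d] unit eig by (simp add: unitary_mat_def col)
qed

lemma pos_semidef_diagonalization:
  fixes A :: "complex^'n^'n"
  assumes "pos_semidef A"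
  obtains U d where "unitary_mat U" "A = U ** real_diag d ** adjoint_mat U" "\<And>j. 0 \<le> d j"
proof -
  obtain U d where U: "unitary_mat U" "A = U ** real_diag d ** adjoint_mat U"
    and eig: "\<And>j. A *v column j U = d j *\<^sub>R column j U"
    using hermitian_diagonalization assms unfolding pos_semidef_def by blast
  have "0 \<le> d j" for j
  proof -
    have "cdot (column j U) (column j U) = (adjoint_mat U ** U) $ j $ j"
      by (simp add: cdot_def matrix_matrix_mult_def adjoint_mat_def column_def)
    then have "cdot (column j U) (column j U) = 1"
      using U(1) by (simp add: unitary_mat_def mat_def)
    moreover have "0 \<le> Re (cdot (column j U) (A *v column j U))"
      using assms by (simp add: pos_semidef_def cdot_def)
    ultimately show ?thesis by (simp add: eig cdot_scaleR_right)
  qed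
  with U that show thesis by blast
qed

section \<open>Spectral calculus\<close>

text \<open>The two diagonalizations say that \<open>M = V* U\<close> intertwines \<open>diag(d)\<close> and \<open>diag(e)\<close>, so \<open>M(i, j) = 0\<close>
  unless \<open>d j = e i\<close>. Hence \<open>M\<close> also intertwines \<open>diag(f \<circ> d)\<close> and \<open>diag(f \<circ> e)\<close>.\<close>

lemma diagonalization_calculus_unique:
  fixes U V :: "complex^'n^'n"
  assumes U: "unitary_mat U" and V: "unitary_mat V"
    and eq: "U ** real_diag d ** adjoint_mat U = V ** real_diag e ** adjoint_mat V"
  shows "U ** real_diag (f \<circ> d) ** adjoint_mat U = V ** real_diag (f \<circ> e) ** adjoint_mat V"
proof -
  define M where "M = adjoint_mat V ** U"
  have u: "adjoint_mat U ** U = mat 1" "U ** adjoint_mat U = mat 1"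
    and v: "adjoint_mat V ** V = mat 1" "V ** adjoint_mat V = mat 1"
    using U V by (auto simp: unitary_mat_def)
  have "adjoint_mat V ** (U ** real_diag d ** adjoint_mat U) ** U
      = adjoint_mat V ** (V ** real_diag e ** adjoint_mat V) ** U"
    using eq by simp
  moreover have "adjoint_mat V ** (U ** real_diag d ** adjoint_mat U) ** U = M ** real_diag d"
    unfolding M_def by (metis matrix_mul_assoc matrix_mul_rid u(1))
  moreover have "adjoint_mat V ** (V ** real_diag e ** adjoint_mat V) ** U = real_diag e ** M"
    unfolding M_def by (metis matrix_mul_assoc matrix_mul_lid v(1))
  ultimately have int: "M ** real_diag d = real_diag e ** M" by simp
  have "(M ** real_diag (f \<circ> d)) $ i $ j = (real_diag (f \<circ> e) ** M) $ i $ j" for i j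
  proof (cases "M $ i $ j = 0")
    case True
    then show ?thesis by (simp add: matrix_mult_real_diag_right matrix_mult_real_diag_left)
  next
    case False
    have "M $ i $ j * of_real (d j) = of_real (e i) * M $ i $ j"
      using int by (metis matrix_mult_real_diag_right matrix_mult_real_diag_left)
    then have "d j = e i" using False by simp
    then show ?thesis by (simp add: matrix_mult_real_diag_right matrix_mult_real_diag_left)
  qed
  then have fint: "M ** real_diag (f \<circ> d) = real_diag (f \<circ> e) ** M" by (simp add: vec_eq_iff)
  have "U ** real_diag (f \<circ> d) ** adjoint_mat U = V ** (M ** real_diag (f \<circ> d)) ** adjoint_mat U"
    unfolding M_def by (metis matrix_mul_assoc matrix_mul_lid v(2))
  also have "\<dots> = V ** (real_diag (f \<circ> e) ** M) ** adjoint_mat U" by (simp only: fint)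
  also have "\<dots> = V ** real_diag (f \<circ> e) ** adjoint_mat V"
    unfolding M_def by (metis matrix_mul_assoc matrix_mul_rid u(2))
  finally show ?thesis .
qed

lemma spectral_calculus_eq:
  assumes "unitary_mat U" "A = U ** real_diag d ** adjoint_mat U"
  shows "spectral_calculus f A = U ** real_diag (f \<circ> d) ** adjoint_mat U"
  unfolding spectral_calculus_def
  by (rule the_equality) (use assms diagonalization_calculus_unique in blast)+

section \<open>The Hilbert-Schmidt norm in a pair of eigenbases\<close>

text \<open>In this form unitary invariance follows from the cyclicity of the trace.\<close>

lemma hs_norm_square_trace:
  "complex_of_real ((hs_norm T)\<^sup>2) = trace (adjoint_mat T ** T)"
proof -
  have "complex_of_real ((hs_norm T)\<^sup>2) = (\<Sum>i\<in>UNIV. \<Sum>j\<in>UNIV. cnj (T $ i $ j) * T $ i $ j)"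
    by (simp add: hs_norm_def sum_nonneg complex_norm_square [symmetric] mult.commute
        del: of_real_power)
  also have "\<dots> = (\<Sum>j\<in>UNIV. \<Sum>i\<in>UNIV. cnj (T $ i $ j) * T $ i $ j)"
    by (rule sum.swap)
  finally show ?thesis by (simp add: trace_def matrix_matrix_mult_def adjoint_mat_def)
qed

lemma adjoint_mat_mult: "adjoint_mat (S ** T) = adjoint_mat T ** adjoint_mat S"
  by (simp add: adjoint_mat_def matrix_matrix_mult_def vec_eq_iff mult.commute)

lemma adjoint_mat_involution: "adjoint_mat (adjoint_mat T) = T"
  by (simp add: adjoint_mat_def vec_eq_iff)

lemma hs_norm_unitary_invariant:
  fixes Z :: "complex^'n^'n"
  assumes "unitary_mat U" "unitary_mat V"
  shows "(hs_norm (U ** Z ** adjoint_mat V))\<^sup>2 = (hs_norm Z)\<^sup>2"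
proof -
  have u: "adjoint_mat U ** U = mat 1" and v: "adjoint_mat V ** V = mat 1"
    using assms by (auto simp: unitary_mat_def)
  have "adjoint_mat (U ** Z ** adjoint_mat V) ** (U ** Z ** adjoint_mat V)
      = V ** (adjoint_mat Z ** (adjoint_mat U ** U) ** Z ** adjoint_mat V)"
    by (simp add: adjoint_mat_mult adjoint_mat_involution matrix_mul_assoc)
  then have "trace (adjoint_mat (U ** Z ** adjoint_mat V) ** (U ** Z ** adjoint_mat V))
      = trace (adjoint_mat Z ** Z ** adjoint_mat V ** V)"
    by (simp add: u trace_mul_sym [of V])
  also have "\<dots> = trace (adjoint_mat Z ** Z)"
    by (simp add: v matrix_mul_assoc [symmetric])
  finally show ?thesis
    unfolding hs_norm_square_trace [symmetric] of_real_eq_iff .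
qed

text \<open>A Schur multiplier whose symbol is \<open>c\<close> evaluated at pairs of eigenvalues; \<open>Y\<close> is the matrix
  \<open>X\<close> written in the eigenbases of \<open>A\<close> and \<open>B\<close>.\<close>

definition eigen_multiplier ::
  "(real \<Rightarrow> real \<Rightarrow> real) \<Rightarrow> ('n \<Rightarrow> real) \<Rightarrow> ('n \<Rightarrow> real) \<Rightarrow> complex^'n^'n \<Rightarrow> complex^'n^'n" where
  "eigen_multiplier c d e Y = (\<chi> i j. of_real (c (d i) (e j)) * Y $ i $ j)"

lemma hs_norm_eigen_multiplier:
  assumes "unitary_mat U" "unitary_mat V"
  shows "(hs_norm (U ** eigen_multiplier c d e Y ** adjoint_mat V))\<^sup>2
       = (\<Sum>i\<in>UNIV. \<Sum>j\<in>UNIV. (c (d i) (e j))\<^sup>2 * (cmod (Y $ i $ j))\<^sup>2)"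
  unfolding hs_norm_unitary_invariant [OF assms]
  by (simp add: hs_norm_def sum_nonneg eigen_multiplier_def norm_mult power_mult_distrib)

lemma unitary_conjugates_product:
  fixes U V Y :: "complex^'n^'n"
  assumes "unitary_mat U" "unitary_mat V"
  shows "(U ** real_diag f ** adjoint_mat U) ** (U ** Y ** adjoint_mat V)
           ** (V ** real_diag g ** adjoint_mat V)
       = U ** (real_diag f ** Y ** real_diag g) ** adjoint_mat V"
proof -
  have u: "adjoint_mat U ** U = mat 1" and v: "adjoint_mat V ** V = mat 1"
    using assms by (auto simp: unitary_mat_def)
  have "(U ** real_diag f ** adjoint_mat U) ** (U ** Y ** adjoint_mat V)
           ** (V ** real_diag g ** adjoint_mat V)
      = U ** real_diag f ** (adjoint_mat U ** U) ** Y ** (adjoint_mat V ** V)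
          ** real_diag g ** adjoint_mat V"
    by (simp only: matrix_mul_assoc)
  then show ?thesis by (simp add: u v matrix_mul_assoc)
qed

lemma mat_powr_product_eigen_multiplier:
  fixes A B Y U V :: "complex^'n^'n"
  assumes U: "unitary_mat U" "A = U ** real_diag d ** adjoint_mat U"
    and V: "unitary_mat V" "B = V ** real_diag e ** adjoint_mat V"
  shows "mat_powr A p ** (U ** Y ** adjoint_mat V) ** mat_powr B q
       = U ** eigen_multiplier (\<lambda>a b. a powr p * b powr q) d e Y ** adjoint_mat V"
proof -
  have "real_diag ((\<lambda>t. t powr p) \<circ> d) ** Y ** real_diag ((\<lambda>t. t powr q) \<circ> e)
      = eigen_multiplier (\<lambda>a b. a powr p * b powr q) d e Y"
    by (simp add: vec_eq_iff matrix_mult_real_diag_right matrix_mult_real_diag_left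
        eigen_multiplier_def mult_ac)
  then show ?thesis
    unfolding mat_powr_def spectral_calculus_eq [OF U] spectral_calculus_eq [OF V]
    by (simp only: unitary_conjugates_product [OF U(1) V(1)])
qed

lemma mult_left_eigen_multiplier:
  fixes A Y U V :: "complex^'n^'n"
  assumes U: "unitary_mat U" "A = U ** real_diag d ** adjoint_mat U"
  shows "A ** (U ** Y ** adjoint_mat V)
       = U ** eigen_multiplier (\<lambda>a b. a) d e Y ** adjoint_mat V"
proof -
  have "A ** (U ** Y ** adjoint_mat V)
      = U ** (real_diag d ** (adjoint_mat U ** U) ** Y) ** adjoint_mat V"
    unfolding U(2) by (simp only: matrix_mul_assoc)
  moreover have "real_diag d ** Y = eigen_multiplier (\<lambda>a b. a) d e Y"
    by (simp add: vec_eq_iff matrix_mult_real_diag_left eigen_multiplier_def)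
  ultimately show ?thesis using U(1) by (simp add: unitary_mat_def)
qed

lemma mult_right_eigen_multiplier:
  fixes B Y U V :: "complex^'n^'n"
  assumes V: "unitary_mat V" "B = V ** real_diag e ** adjoint_mat V"
  shows "(U ** Y ** adjoint_mat V) ** B
       = U ** eigen_multiplier (\<lambda>a b. b) d e Y ** adjoint_mat V"
proof -
  have "(U ** Y ** adjoint_mat V) ** B
      = U ** (Y ** (adjoint_mat V ** V) ** real_diag e) ** adjoint_mat V"
    unfolding V(2) by (simp only: matrix_mul_assoc)
  moreover have "Y ** real_diag e = eigen_multiplier (\<lambda>a b. b) d e Y"
    by (simp add: vec_eq_iff matrix_mult_real_diag_right eigen_multiplier_def)
  ultimately show ?thesis using V(1) by (simp add: unitary_mat_def)
qed

lemma eigen_multiplier_add: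
  fixes U W Y :: "complex^'n^'n"
  shows "U ** eigen_multiplier c d e Y ** W + U ** eigen_multiplier c' d e Y ** W
     = U ** eigen_multiplier (\<lambda>a b. c a b + c' a b) d e Y ** W"
proof -
  have "eigen_multiplier c d e Y + eigen_multiplier c' d e Y
      = eigen_multiplier (\<lambda>a b. c a b + c' a b) d e Y"
    by (simp add: vec_eq_iff eigen_multiplier_def algebra_simps)
  moreover have "P ** W + Q ** W = (P + Q) ** W" for P Q :: "complex^'n^'n"
    by (simp add: vec_eq_iff matrix_matrix_mult_def distrib_right sum.distrib)
  ultimately show ?thesis by (simp only: matrix_add_ldistrib [symmetric])
qed

lemma eigen_multiplier_scaleR:
  fixes U W Y :: "complex^'n^'n"
  shows "s *\<^sub>R (U ** eigen_multiplier c d e Y ** W)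
     = U ** eigen_multiplier (\<lambda>a b. s * c a b) d e Y ** W"
proof -
  have "eigen_multiplier (\<lambda>a b. s * c a b) d e Y = s *\<^sub>R eigen_multiplier c d e Y"
    by (simp add: vec_eq_iff eigen_multiplier_def scaleR_conv_of_real [where 'a = complex])
  then show ?thesis
    by (simp add: matrix_scalar_ac scalar_matrix_assoc)
qed

section \<open>The two-sided estimate\<close>

theorem theorem3p9:
  fixes A B X :: "complex^'n^'n"
    and \<phi> :: "real \<Rightarrow> real"
    and \<nu> r R r0 lo up :: real
  assumes "pos_semidef A" and "pos_semidef B"
    and "strict_mono_on {0..} \<phi>" and "convex_on {0..} \<phi>"
    and "0 < \<nu>" and "\<nu> \<le> 1 / 2"
    and "r = min \<nu> (1 - \<nu>)" and "R = max \<nu> (1 - \<nu>)" and "r0 = min (2 * r) (1 - 2 * r)"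
    and "lo = 4 * (r\<^sup>2 * (hs_norm (mat_powr A (1/2) ** X ** mat_powr B (1/2)))\<^sup>2
                 + r0 * (hs_norm (mat_powr A (3/4) ** X ** mat_powr B (1/4)))\<^sup>2)
             - r0 * (hs_norm (mat_powr A (1/2) ** X ** mat_powr B (1/2) + A ** X))\<^sup>2"
    and "up = 4 * (R\<^sup>2 * (hs_norm (mat_powr A (1/2) ** X ** mat_powr B (1/2)))\<^sup>2
                 + r0 * (hs_norm (mat_powr A (1/4) ** X ** mat_powr B (3/4)))\<^sup>2)
             - r0 * (hs_norm (mat_powr A (1/2) ** X ** mat_powr B (1/2) + X ** B))\<^sup>2"
  shows "(0 \<le> lo \<longrightarrow>
            \<phi> (r\<^sup>2 * (hs_norm (A ** X + X ** B))\<^sup>2) - \<phi> lo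
            \<le> \<phi> ((hs_norm ((1 - \<nu>) *\<^sub>R (A ** X) + \<nu> *\<^sub>R (X ** B)))\<^sup>2)
              - \<phi> ((hs_norm (mat_powr A (1 - \<nu>) ** X ** mat_powr B \<nu>))\<^sup>2)) \<and>
         (0 \<le> up \<longrightarrow>
            \<phi> ((hs_norm ((1 - \<nu>) *\<^sub>R (A ** X) + \<nu> *\<^sub>R (X ** B)))\<^sup>2)
              - \<phi> ((hs_norm (mat_powr A (1 - \<nu>) ** X ** mat_powr B \<nu>))\<^sup>2)
            \<le> \<phi> (R\<^sup>2 * (hs_norm (A ** X + X ** B))\<^sup>2) - \<phi> up)"
proof -
  have r: "r = \<nu>" and R: "R = 1 - \<nu>" and r0: "r0 = min (2 * \<nu>) (1 - 2 * \<nu>)"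
    using assms(5-9) by auto
  have r0_nonneg: "0 \<le> r0" using assms(5,6) by (simp add: r0)
  obtain U d where U: "unitary_mat U" "A = U ** real_diag d ** adjoint_mat U"
    and d: "\<And>i. 0 \<le> d i"
    using pos_semidef_diagonalization [OF assms(1)] by blast
  obtain V e where V: "unitary_mat V" "B = V ** real_diag e ** adjoint_mat V"
    and e: "\<And>j. 0 \<le> e j"
    using pos_semidef_diagonalization [OF assms(2)] by blast
  define Y where "Y = adjoint_mat U ** X ** V"
  have X: "X = U ** Y ** adjoint_mat V"
    unfolding Y_def using U(1) V(1)
    by (metis unitary_mat_def matrix_mul_assoc matrix_mul_lid matrix_mul_rid)
  \<comment> \<open>The weighted sum over pairs of eigenvalues: every squared norm below is \<open>N\<close> of a scalar function.\<close>
  define N where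
    "N c = (\<Sum>i\<in>UNIV. \<Sum>j\<in>UNIV. c (d i) (e j) * (cmod (Y $ i $ j))\<^sup>2)"
    for c :: "real \<Rightarrow> real \<Rightarrow> real"
  note em = mult_left_eigen_multiplier [OF U, of Y V e] mult_right_eigen_multiplier [OF V, of U Y d]
    mat_powr_product_eigen_multiplier [OF U V, of _ Y]
    eigen_multiplier_add eigen_multiplier_scaleR
    hs_norm_eigen_multiplier [OF U(1) V(1)]
  have AXB: "(hs_norm (mat_powr A p ** X ** mat_powr B q))\<^sup>2
      = N (\<lambda>a b. (a powr p * b powr q)\<^sup>2)" for p q
    by (simp only: X em N_def)
  have gm_ax: "(hs_norm (mat_powr A (1/2) ** X ** mat_powr B (1/2) + A ** X))\<^sup>2
      = N (\<lambda>a b. (a powr (1/2) * b powr (1/2) + a)\<^sup>2)"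
    by (simp only: X em N_def)
  have gm_xb: "(hs_norm (mat_powr A (1/2) ** X ** mat_powr B (1/2) + X ** B))\<^sup>2
      = N (\<lambda>a b. (b powr (1/2) * a powr (1/2) + b)\<^sup>2)"
    by (simp only: X em N_def mult.commute [of "_ powr _" "_ powr _"])
  have am: "(hs_norm ((1 - \<nu>) *\<^sub>R (A ** X) + \<nu> *\<^sub>R (X ** B)))\<^sup>2
      = N (\<lambda>a b. ((1 - \<nu>) * a + \<nu> * b)\<^sup>2)"
    by (simp only: X em N_def)
  have sum: "s\<^sup>2 * (hs_norm (A ** X + X ** B))\<^sup>2 = N (\<lambda>a b. (s * (a + b))\<^sup>2)" for s
    by (simp only: X em N_def sum_distrib_left power_mult_distrib mult.assoc)
  have N_mono: "N c \<le> N c'" if "\<And>a b. 0 \<le> a \<Longrightarrow> 0 \<le> b \<Longrightarrow> c a b \<le> c' a b" for c c'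
    unfolding N_def by (intro sum_mono mult_right_mono that d e) simp
  have N_add: "N c + N c' = N (\<lambda>a b. c a b + c' a b)" for c c'
    by (simp add: N_def sum.distrib distrib_right)
  have N_diff: "N c - N c' = N (\<lambda>a b. c a b - c' a b)" for c c'
    by (simp add: N_def sum_subtractf left_diff_distrib)
  have N_scale: "s * N c = N (\<lambda>a b. s * c a b)" for s c
    by (simp add: N_def sum_distrib_left mult.assoc)
  have N_cong: "N c = N c'" if "\<And>a b. 0 \<le> a \<Longrightarrow> 0 \<le> b \<Longrightarrow> c a b = c' a b" for c c'
    by (intro antisym N_mono) (simp_all add: that)
  have N_nonneg: "0 \<le> N c" if "\<And>a b. 0 \<le> a \<Longrightarrow> 0 \<le> b \<Longrightarrow> 0 \<le> c a b" for c
    unfolding N_def by (intro sum_nonneg mult_nonneg_nonneg that d e) simp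
  have lo: "lo = N (\<lambda>a b. 4 * \<nu>\<^sup>2 * (a * b) - r0 * (a - sqrt a * sqrt b)\<^sup>2)"
    unfolding assms(10) AXB gm_ax r N_scale N_add N_diff
    by (rule N_cong) (rule lower_terms_defect)
  have up: "up = N (\<lambda>a b. 4 * (1 - \<nu>)\<^sup>2 * (a * b) - r0 * (b - sqrt b * sqrt a)\<^sup>2)"
    unfolding assms(11) AXB gm_xb R N_scale N_add N_diff
  proof (rule N_cong)
    fix a b :: real
    assume "0 \<le> a" "0 \<le> b"
    then show "4 * ((1 - \<nu>)\<^sup>2 * (a powr (1/2) * b powr (1/2))\<^sup>2
          + r0 * (a powr (1/4) * b powr (3/4))\<^sup>2) - r0 * (b powr (1/2) * a powr (1/2) + b)\<^sup>2
        = 4 * (1 - \<nu>)\<^sup>2 * (a * b) - r0 * (b - sqrt b * sqrt a)\<^sup>2"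
      using lower_terms_defect [of b a "1 - \<nu>" r0] by (simp only: mult.commute)
  qed
  \<comment> \<open>With \<open>s = \<nu>\<close> this orders the end points of the interval that starts at \<open>lo\<close>.\<close>
  have defect: "4 * s\<^sup>2 * (a * b) - r0 * t\<^sup>2 \<le> (s * (a + b))\<^sup>2" for a b s t :: real
  proof -
    have "(s * (a + b))\<^sup>2 - 4 * s\<^sup>2 * (a * b) = (s * (a - b))\<^sup>2"
      by (simp add: power2_eq_square algebra_simps)
    moreover have "0 \<le> r0 * t\<^sup>2" using r0_nonneg by simp
    ultimately show ?thesis by (smt (verit) zero_le_power2)
  qed
  have mono: "mono_on {0..} \<phi>"
    using assms(3) by (rule strict_mono_on_imp_mono_on)
  have young: "(a powr (1 - \<nu>) * b powr \<nu>)\<^sup>2 \<le> ((1 - \<nu>) * a + \<nu> * b)\<^sup>2"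
    if "0 \<le> a" "0 \<le> b" for a b
    using Young_powr [of \<nu> a b] assms(5,6) that by (intro power_mono) auto
  let ?M = "N (\<lambda>a b. ((1 - \<nu>) * a + \<nu> * b)\<^sup>2)"
  let ?G = "N (\<lambda>a b. (a powr (1 - \<nu>) * b powr \<nu>)\<^sup>2)"
  have "\<phi> (N (\<lambda>a b. (\<nu> * (a + b))\<^sup>2)) - \<phi> lo \<le> \<phi> ?M - \<phi> ?G" if "0 \<le> lo"
  proof (rule convex_increasing_increment_mono [OF mono assms(4) that])
    show "lo \<le> N (\<lambda>a b. (\<nu> * (a + b))\<^sup>2)"
      unfolding lo by (rule N_mono) (rule defect)
    show "0 \<le> ?G" by (rule N_nonneg) simp
    show "N (\<lambda>a b. (\<nu> * (a + b))\<^sup>2) \<le> ?M"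
    proof (rule N_mono)
      fix a b :: real
      assume "0 \<le> a" "0 \<le> b"
      then have "\<nu> * a \<le> (1 - \<nu>) * a" using assms(6) by (intro mult_right_mono) auto
      then show "(\<nu> * (a + b))\<^sup>2 \<le> ((1 - \<nu>) * a + \<nu> * b)\<^sup>2"
        using \<open>0 \<le> a\<close> \<open>0 \<le> b\<close> assms(5)
        by (intro power_mono) (auto simp: distrib_left)
    qed
    have "N (\<lambda>a b. (\<nu> * (a + b))\<^sup>2) + ?G \<le> ?M + lo"
      unfolding lo N_add r0
      by (rule N_mono) (rule lower_scalar_comparison [OF _ _ assms(5,6)])
    then show "N (\<lambda>a b. (\<nu> * (a + b))\<^sup>2) - lo \<le> ?M - ?G" by simp
  qed
  moreover have "\<phi> ?M - \<phi> ?G \<le> \<phi> (N (\<lambda>a b. ((1 - \<nu>) * (a + b))\<^sup>2)) - \<phi> up" if "0 \<le> up"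
  proof (rule convex_increasing_increment_mono [OF mono assms(4)])
    show "0 \<le> ?G" by (rule N_nonneg) simp
    show "?G \<le> ?M" by (rule N_mono) (rule young)
    show "?M \<le> N (\<lambda>a b. ((1 - \<nu>) * (a + b))\<^sup>2)"
    proof (rule N_mono)
      fix a b :: real
      assume "0 \<le> a" "0 \<le> b"
      then have "\<nu> * b \<le> (1 - \<nu>) * b" using assms(6) by (intro mult_right_mono) auto
      then show "((1 - \<nu>) * a + \<nu> * b)\<^sup>2 \<le> ((1 - \<nu>) * (a + b))\<^sup>2"
        using \<open>0 \<le> a\<close> \<open>0 \<le> b\<close> assms(5,6)
        by (intro power_mono) (auto simp: distrib_left)
    qed
    have "?M + up \<le> N (\<lambda>a b. ((1 - \<nu>) * (a + b))\<^sup>2) + ?G"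
      unfolding up N_add r0
      by (rule N_mono) (rule upper_scalar_comparison [OF _ _ assms(5,6)])
    then show "?M - ?G \<le> N (\<lambda>a b. ((1 - \<nu>) * (a + b))\<^sup>2) - up" by simp
  qed (rule that)
  ultimately show ?thesis
    unfolding AXB am sum unfolding r R by blast
qed

end
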